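(* Let $K$ be a field of characteristic zero, let $n\ge 2$, let $P_{n+1}=K[x_1,\dots,x_{n+1}]$ be the polynomial algebra, and let $\sigma$ be the $K$-algebra automorphism of $P_{n+1}$ given by $\sigma(x_1)=x_1$ and $\sigma(x_i)=x_i+x_{i-1}$ for $2\le i\le n+1$. Set $m:=[\frac n2]$ and $\mu:=[\frac{n-1}2]$. Let $p_1,\dots,p_m$ and $q_1,\dots,q_\mu$ be the explicit polynomials defined in the context. Then the set of elements $$x_1,\,p_1,\dots,p_m,\,q_1,\dots,q_\mu$$ of $P_{n+1}^\sigma$ is a transcendence basis for the algebra $P_{n+1}^\sigma$, with $\deg(p_i)=2$ and $\deg(q_j)=3$. Further, denoting by $P_{n+1,x_1}=K[x_1^{-1},x_1,x_2,\dots,x_{n+1}]$ the localization of $P_{n+1}$ at the powers of $x_1$ (with the unique extension of $\sigma$ to it), $$P_{n+1,x_1}^\sigma=K[x_1,x_1^{-1}][p_1,\dots,p_m,q_1,\dots,q_\mu].$$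
   Context: $A^\sigma$ denotes the subalgebra of elements fixed by $\sigma$; $[r]$ is the floor of $r$. Convention: $\binom{a}{b}=0$ for integers $a,b$ not satisfying $0\le b\le a$. Put $\lambda_{i,j}^k=(-1)^{k-i}\{\binom{k-i}{j-k}+\binom{k-i-1}{j-k-1}\}$, $\mu_i^k=(-1)^{k-1}\{\binom{k}{i-k}+\binom{k-1}{i-k-1}\}$, $\alpha_{i,j}^k=(-1)^{k-i}\{2\binom{k-i-1}{j-k-1}+3\binom{k-i-1}{j-k-2}+(k-i-1)[\binom{k-i}{j-k-1}+\binom{k-i-1}{j-k-2}]\}$, and $\beta_j^k=\alpha_{1,j-1}^k+\alpha_{1,j}^k+\mu_{j-1}^k$ for $j=k+1,\dots,2k+1$. Then $$p_k=x_{k+1}^2+\sum_{i=1}^{k-1}\sum_{j=k}^{2k-i}\lambda_{i,j}^k x_{i+1}x_{j+1}-x_1\sum_{i=k}^{2k}\mu_i^kx_{i+1}\quad(k\ge 1),$$ $$q_1=-x_2^3+3x_1x_2x_3+x_1^2x_2-3x_1^2x_4,$$ $$q_k=-x_2p_k+x_1x_{k+1}x_{k+2}+x_1\sum_{i=1}^{k-1}\sum_{j=k+1}^{2k-i+1}\alpha_{i,j}^kx_{i+1}x_{j+1}-x_1^2\sum_{i=k+1}^{2k+1}\beta_i^kx_{i+1}\quad(k\ge 2).$$ *)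

theory Defs
  imports
    "HOL-Library.Poly_Mapping"
    "HOL-Computational_Algebra.Polynomial_Factorial"
begin

text \<open>
  Commutative polynomials over \<open>'a\<close> are finitely supported functions on the monomials,
  and monomials are finitely supported exponent functions on the set \<open>'i\<close> of variable names.
  Multiplication is convolution.
\<close>

type_synonym ('i, 'a) mpoly = "('i \<Rightarrow>\<^sub>0 nat) \<Rightarrow>\<^sub>0 'a"

definition Const :: "'a \<Rightarrow> ('i, 'a::comm_ring_1) mpoly" where
  "Const c = Poly_Mapping.single 0 c"

definition X :: "'i \<Rightarrow> ('i, 'a::comm_ring_1) mpoly" where
  "X i = Poly_Mapping.single (Poly_Mapping.single i 1) 1"

definition Polys :: "'i set \<Rightarrow> ('i, 'a::comm_ring_1) mpoly set" where
  "Polys V = {F. \<forall>m \<in> Poly_Mapping.keys F. Poly_Mapping.keys m \<subseteq> V}"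

definition total_degree :: "('i, 'a::comm_ring_1) mpoly \<Rightarrow> nat" where
  "total_degree F =
     Max (insert 0 ((\<lambda>m. \<Sum>i\<in>Poly_Mapping.keys m. Poly_Mapping.lookup m i) ` Poly_Mapping.keys F))"

text \<open>The value of a polynomial under the substitution \<open>f\<close>, in a polynomial algebra.\<close>

definition peval ::
  "('i \<Rightarrow> ('j, 'a::comm_ring_1) mpoly) \<Rightarrow> ('i, 'a) mpoly \<Rightarrow> ('j, 'a) mpoly" where
  "peval f F = (\<Sum>m\<in>Poly_Mapping.keys F.
     Const (Poly_Mapping.lookup F m) * (\<Prod>i\<in>Poly_Mapping.keys m. f i ^ Poly_Mapping.lookup m i))"

text \<open>\<open>adjoin R S\<close> is the ring \<open>R[S]\<close>, the smallest subring containing \<open>R\<close> and \<open>S\<close>.\<close>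

inductive_set adjoin :: "'b::comm_ring_1 set \<Rightarrow> 'b set \<Rightarrow> 'b set" for R S where
  base: "a \<in> R \<Longrightarrow> a \<in> adjoin R S"
| gen: "s \<in> S \<Longrightarrow> s \<in> adjoin R S"
| zero: "0 \<in> adjoin R S"
| one: "1 \<in> adjoin R S"
| uminus: "a \<in> adjoin R S \<Longrightarrow> - a \<in> adjoin R S"
| add: "a \<in> adjoin R S \<Longrightarrow> b \<in> adjoin R S \<Longrightarrow> a + b \<in> adjoin R S"
| mult: "a \<in> adjoin R S \<Longrightarrow> b \<in> adjoin R S \<Longrightarrow> a * b \<in> adjoin R S"

text \<open>In \<open>alg_independent\<close> the elements of \<open>S\<close> themselves serve as the names of the variables.\<close>

definition alg_independent :: "('i, 'a::comm_ring_1) mpoly set \<Rightarrow> bool" where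
  "alg_independent S \<longleftrightarrow>
     (\<forall>F :: (('i, 'a) mpoly, 'a) mpoly. F \<in> Polys S \<longrightarrow> peval (\<lambda>s. s) F = 0 \<longrightarrow> F = 0)"

definition algebraic_over :: "'b::comm_ring_1 set \<Rightarrow> 'b \<Rightarrow> bool" where
  "algebraic_over R a \<longleftrightarrow> (\<exists>f. f \<noteq> 0 \<and> (\<forall>i. coeff f i \<in> R) \<and> poly f a = 0)"

definition transcendence_basis ::
  "('i, 'a::comm_ring_1) mpoly set \<Rightarrow> ('i, 'a) mpoly set \<Rightarrow> bool" where
  "transcendence_basis A S \<longleftrightarrow>
     S \<subseteq> A \<and> alg_independent S \<and> (\<forall>a\<in>A. algebraic_over (adjoin (range Const) S) a)"

text \<open>
  All polynomial algebras live in \<open>(nat, 'a) mpoly\<close>, where \<open>PolyAlg N\<close> is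
  \<open>K[x\<^sub>1, \<dots>, x\<^sub>N]\<close>. The single endomorphism \<open>sigma\<close> restricts to the given automorphism
  of each \<open>PolyAlg N\<close>.
\<close>

abbreviation PolyAlg :: "nat \<Rightarrow> (nat, 'a::comm_ring_1) mpoly set" where
  "PolyAlg N \<equiv> Polys {1..N}"

definition sigma :: "(nat, 'a::comm_ring_1) mpoly \<Rightarrow> (nat, 'a) mpoly" where
  "sigma = peval (\<lambda>i. if 2 \<le> i then X i + X (i - 1) else X i)"

definition invariants :: "nat \<Rightarrow> (nat, 'a::comm_ring_1) mpoly set" where
  "invariants N = {F \<in> PolyAlg N. sigma F = F}"

text \<open>
  The localization at the powers of \<open>x\<^sub>1\<close>, as a subring of the field of fractions;
  \<open>sigma_loc\<close> is well defined by \<open>sigma_loc_Fract\<close> below.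
\<close>

definition PolyAlg_loc :: "nat \<Rightarrow> (nat, 'a::field) mpoly fract set" where
  "PolyAlg_loc N = {Fract F (X 1 ^ k) | F k. F \<in> PolyAlg N}"

definition sigma_loc :: "(nat, 'a::field) mpoly fract \<Rightarrow> (nat, 'a) mpoly fract" where
  "sigma_loc z = (THE w. \<exists>F k. z = Fract F (X 1 ^ k) \<and> w = Fract (sigma F) (X 1 ^ k))"

definition invariants_loc :: "nat \<Rightarrow> (nat, 'a::field) mpoly fract set" where
  "invariants_loc N = {z \<in> PolyAlg_loc N. sigma_loc z = z}"

text \<open>\<open>binom a b\<close> vanishes unless \<open>0 \<le> b \<le> a\<close>, in particular whenever \<open>a\<close> is negative.\<close>

definition binom :: "int \<Rightarrow> int \<Rightarrow> int" where
  "binom a b = (if 0 \<le> b \<and> b \<le> a then int (nat a choose nat b) else 0)"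

text \<open>
  Below, the upper index \<open>k\<close> comes first: \<open>lam k i j\<close> is \<open>\<lambda>\<^sub>i\<^sub>,\<^sub>j\<^sup>k\<close>. The truncated differences
  in the signs are only used with \<open>i < k\<close> and \<open>1 \<le> k\<close>, where they are the true differences.
\<close>

definition lam :: "nat \<Rightarrow> nat \<Rightarrow> nat \<Rightarrow> int" where
  "lam k i j = (-1) ^ (k - i) *
     (binom (int k - int i) (int j - int k) + binom (int k - int i - 1) (int j - int k - 1))"

definition mu :: "nat \<Rightarrow> nat \<Rightarrow> int" where
  "mu k i = (-1) ^ (k - 1) *
     (binom (int k) (int i - int k) + binom (int k - 1) (int i - int k - 1))"

definition alpha :: "nat \<Rightarrow> nat \<Rightarrow> nat \<Rightarrow> int" where
  "alpha k i j = (-1) ^ (k - i) *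
     (2 * binom (int k - int i - 1) (int j - int k - 1)
      + 3 * binom (int k - int i - 1) (int j - int k - 2)
      + (int k - int i - 1) *
          (binom (int k - int i) (int j - int k - 1)
           + binom (int k - int i - 1) (int j - int k - 2)))"

definition beta :: "nat \<Rightarrow> nat \<Rightarrow> int" where
  "beta k j = alpha k 1 (j - 1) + alpha k 1 j + mu k (j - 1)"

definition p :: "nat \<Rightarrow> (nat, 'a::comm_ring_1) mpoly" where
  "p k = X (k + 1) ^ 2
     + (\<Sum>i = 1..k - 1. \<Sum>j = k..2 * k - i. of_int (lam k i j) * X (i + 1) * X (j + 1))
     - X 1 * (\<Sum>i = k..2 * k. of_int (mu k i) * X (i + 1))"

definition q :: "nat \<Rightarrow> (nat, 'a::comm_ring_1) mpoly" where
  "q k = (if k = 1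
     then - (X 2 ^ 3) + 3 * X 1 * X 2 * X 3 + X 1 ^ 2 * X 2 - 3 * X 1 ^ 2 * X 4
     else - X 2 * p k + X 1 * X (k + 1) * X (k + 2)
       + X 1 * (\<Sum>i = 1..k - 1. \<Sum>j = k + 1..2 * k - i + 1.
           of_int (alpha k i j) * X (i + 1) * X (j + 1))
       - X 1 ^ 2 * (\<Sum>i = k + 1..2 * k + 1. of_int (beta k i) * X (i + 1)))"

lemma mpoly_induct [case_names zero single add]:
  fixes F :: "('i, 'a::comm_ring_1) mpoly"
  assumes "P 0" "\<And>m c. P (Poly_Mapping.single m c)" "\<And>F G. P F \<Longrightarrow> P G \<Longrightarrow> P (F + G)"
  shows "P F"
proof (induction F rule: update_induct)
  case const
  then show ?case using assms(1) by (simp only: zero_poly_mapping.abs_eq)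
next
  case (update F m c)
  from update(1) have "Poly_Mapping.lookup F m = 0"
    by (simp only: not_in_keys_iff_lookup_eq_zero)
  then have "Poly_Mapping.update m c F = F + Poly_Mapping.single m c"
    by (intro poly_mapping_eqI) (auto simp: lookup_update lookup_add lookup_single when_def)
  then show ?case using update assms by simp
qed

lemma Const_1: "Const 1 = 1"
  by (simp add: Const_def)

lemma Const_mult: "Const (c * d) = Const c * Const d"
  by (simp add: Const_def mult_single)

lemma peval_superset:
  assumes "finite A" "Poly_Mapping.keys F \<subseteq> A"
  shows "peval f F = (\<Sum>m\<in>A. Const (Poly_Mapping.lookup F m) *
           (\<Prod>i\<in>Poly_Mapping.keys m. f i ^ Poly_Mapping.lookup m i))"
  unfolding peval_def using assms
  by (intro sum.mono_neutral_left) (simp_all add: Const_def not_in_keys_iff_lookup_eq_zero)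

lemma peval_0 [simp]: "peval f 0 = 0"
  by (simp add: peval_def)

lemma peval_add [simp]: "peval f (F + G) = peval f F + peval f G"
proof -
  let ?A = "Poly_Mapping.keys F \<union> Poly_Mapping.keys G"
  have "Poly_Mapping.keys (F + G) \<subseteq> ?A" by (rule keys_add)
  then show ?thesis
    by (simp add: peval_superset[where A = ?A] lookup_add Const_def single_add
        distrib_right sum.distrib)
qed

lemma peval_single:
  "peval f (Poly_Mapping.single m c) =
     Const c * (\<Prod>i\<in>Poly_Mapping.keys m. f i ^ Poly_Mapping.lookup m i)"
  by (subst peval_superset[where A = "{m}"]) auto

lemma peval_mult [simp]: "peval f (F * G) = peval f F * peval f G"
proof (induction F rule: mpoly_induct)
  case (single m c)
  show ?case
  proof (induction G rule: mpoly_induct)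
    case (single n d)
    let ?A = "Poly_Mapping.keys m \<union> Poly_Mapping.keys n"
    have *: "(\<Prod>i\<in>Poly_Mapping.keys l. f i ^ Poly_Mapping.lookup l i) =
        (\<Prod>i\<in>?A. f i ^ Poly_Mapping.lookup l i)" if "Poly_Mapping.keys l \<subseteq> ?A" for l
      using that
      by (intro prod.mono_neutral_left) (simp_all add: not_in_keys_iff_lookup_eq_zero)
    have mn: "Poly_Mapping.keys (m + n) \<subseteq> ?A" by (rule keys_add)
    have "peval f (Poly_Mapping.single m c * Poly_Mapping.single n d) =
        Const c * Const d * (\<Prod>i\<in>?A. f i ^ Poly_Mapping.lookup (m + n) i)"
      by (simp only: mult_single peval_single Const_mult *[OF mn])
    also have "\<dots> = (Const c * (\<Prod>i\<in>?A. f i ^ Poly_Mapping.lookup m i)) *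
        (Const d * (\<Prod>i\<in>?A. f i ^ Poly_Mapping.lookup n i))"
      by (simp only: lookup_add power_add prod.distrib mult_ac)
    also have "\<dots> = peval f (Poly_Mapping.single m c) * peval f (Poly_Mapping.single n d)"
      by (simp only: peval_single *[of m, OF Un_upper1] *[of n, OF Un_upper2])
    finally show ?case .
  qed (simp_all add: distrib_left)
qed (simp_all add: distrib_right)

lemma sigma_add: "sigma (F + G) = sigma F + sigma G"
  by (simp add: sigma_def)

lemma sigma_mult: "sigma (F * G) = sigma F * sigma G"
  by (simp add: sigma_def)

lemma sigma_Const: "sigma (Const c) = Const c"
  by (subst Const_def) (simp add: sigma_def peval_single)

lemma sigma_X: "sigma (X i) = (if 2 \<le> i then X i + X (i - 1) else X i)"
  by (subst X_def) (simp add: sigma_def peval_single Const_1)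

lemma sigma_X1_power: "sigma (X 1 ^ k) = X 1 ^ k"
  by (induction k) (use sigma_Const[of 1] in \<open>simp_all add: sigma_mult sigma_X Const_1\<close>)

lemma X_nonzero: "X i \<noteq> (0 :: ('i, 'a::comm_ring_1) mpoly)"
proof
  assume "X i = (0 :: ('i, 'a) mpoly)"
  then have "Poly_Mapping.lookup (X i :: ('i, 'a) mpoly) (Poly_Mapping.single i 1) = 0" by simp
  then show False by (simp add: X_def)
qed

lemma sigma_loc_Fract:
  fixes F :: "(nat, 'a::field) mpoly"
  shows "sigma_loc (Fract F (X 1 ^ k)) = Fract (sigma F) (X 1 ^ k)"
  unfolding sigma_loc_def
proof (rule the_equality)
  fix w :: "(nat, 'a) mpoly fract"
  assume "\<exists>G l. Fract F (X 1 ^ k) = Fract G (X 1 ^ l) \<and> w = Fract (sigma G) (X 1 ^ l)"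
  then obtain G l where eq: "Fract F (X 1 ^ k) = Fract G (X 1 ^ l)"
    and w: "w = Fract (sigma G) (X 1 ^ l)" by blast
  from eq have "F * X 1 ^ l = G * X 1 ^ k"
    by (simp add: eq_fract X_nonzero)
  then have "sigma F * X 1 ^ l = sigma G * X 1 ^ k"
    by (metis sigma_mult sigma_X1_power)
  then show "w = Fract (sigma F) (X 1 ^ k)"
    by (simp add: w eq_fract X_nonzero)
qed blast

end

theory Submission
  imports Defs
begin

text \<open>
  Each generator after \<open>x\<^sub>1\<close> has the form \<open>c x\<^sub>1\<^sup>e x\<^bsub>t+2\<^esub> + L\<close> with \<open>c \<noteq> 0\<close> constant and \<open>L\<close> a
  polynomial in \<open>x\<^sub>1, \<dots>, x\<^bsub>t+1\<^esub>\<close>, one for each \<open>t = 1, \<dots>, n - 1\<close>. This gives their algebraic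
  independence, and it shows that after multiplication by a power of \<open>x\<^sub>1\<close> every polynomial \<open>F\<close>
  becomes \<open>f(x\<^sub>2)\<close> for some \<open>f\<close> with coefficients in the algebra \<open>A\<close> of the generators. If \<open>F\<close> is
  invariant, applying \<open>\<sigma>\<close> repeatedly shows that \<open>f\<close> takes the same value at \<open>x\<^sub>2 + k x\<^sub>1\<close> for all
  \<open>k\<close>, so in characteristic zero \<open>f\<close> is constant and a power of \<open>x\<^sub>1\<close> times \<open>F\<close> lies in \<open>A\<close>.

  For the invariance, \<open>\<sigma>\<close> acts on the sequence \<open>x\<^sub>1, x\<^sub>2, \<dots>\<close> as \<open>1 + E\<inverse>\<close> for the shift \<open>E\<close>, and
  the binomial coefficients in \<open>p\<^sub>k\<close> and \<open>q\<^sub>k\<close> are those of powers of \<open>1 + E\<close>. The quadratic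
  forms are alternating sums that telescope under \<open>\<sigma> - 1\<close>, which annihilates \<open>p\<^sub>k\<close> and maps the
  quadratic form \<open>g\<^sub>k\<close> in \<open>q\<^sub>k = - x\<^sub>2 p\<^sub>k + x\<^sub>1 g\<^sub>k\<close> to \<open>p\<^sub>k\<close>.
\<close>

section \<open>Polynomials\<close>

lemma Const_0: "Const 0 = 0"
  by (simp add: Const_def)

lemma Const_uminus: "Const (- c) = - Const c"
  by (simp add: Const_def single_uminus)

lemma peval_Const [simp]: "peval f (Const c) = Const c"
  by (subst Const_def) (simp add: peval_single)

lemma peval_X [simp]: "peval f (X i) = f i"
  by (subst X_def) (simp add: peval_single Const_1)

lemma peval_1 [simp]: "peval f 1 = 1"
  using peval_Const[of f 1] by (simp add: Const_1)

lemma peval_uminus [simp]: "peval f (- F) = - peval f F"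
  using peval_add[of f F "- F"] by (simp add: eq_neg_iff_add_eq_0 add.commute)

lemma peval_diff [simp]: "peval f (F - G) = peval f F - peval f G"
  using peval_add[of f F "- G"] by simp

lemma peval_power [simp]: "peval f (F ^ k) = peval f F ^ k"
  by (induction k) simp_all

lemma peval_sum: "peval f (sum g A) = (\<Sum>a\<in>A. peval f (g a))"
  by (induction A rule: infinite_finite_induct) simp_all

lemma peval_of_nat [simp]: "peval f (of_nat k) = of_nat k"
  by (induction k) simp_all

lemma peval_numeral [simp]: "peval f (numeral k) = numeral k"
  using peval_of_nat[of f "numeral k"] by simp

lemma peval_poly: "peval f (poly g a) = poly (map_poly (peval f) g) (peval f a)"
  by (induction g) (simp_all add: map_poly_pCons)

lemma peval_cong:
  "F \<in> Polys V \<Longrightarrow> (\<And>i. i \<in> V \<Longrightarrow> f i = g i) \<Longrightarrow> peval f F = peval g F"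
  unfolding peval_def Polys_def by (intro sum.cong arg_cong2[where f = "(*)"] arg_cong2[where f = "(^)"] prod.cong) auto

lemma X_power: "X i ^ k = Poly_Mapping.single (Poly_Mapping.single i k) 1"
  by (induction k) (simp_all add: X_def mult_single flip: single_add)

lemma prod_single: "(\<Prod>i\<in>A. Poly_Mapping.single (f i) (1::'a::comm_ring_1)) = Poly_Mapping.single (sum f A) 1"
  by (induction A rule: infinite_finite_induct) (simp_all add: mult_single)

lemma sum_single_lookup: "(\<Sum>i\<in>Poly_Mapping.keys m. Poly_Mapping.single i (Poly_Mapping.lookup m i)) = m"
  by (rule poly_mapping_eqI)
    (auto simp: lookup_sum lookup_single when_def sum.If_cases not_in_keys_iff_lookup_eq_zero
       sum.delta)

lemma peval_X_id [simp]: "peval X F = F"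
  by (induction F rule: mpoly_induct)
    (simp_all add: peval_single X_power prod_single sum_single_lookup Const_def mult_single)

section \<open>Polynomials in a given set of variables, and rings generated by a set\<close>

lemma zero_Polys [simp]: "0 \<in> Polys V"
  and Const_Polys [simp]: "Const c \<in> Polys V"
  and X_Polys: "i \<in> V \<Longrightarrow> X i \<in> Polys V"
  by (auto simp: Polys_def Const_def X_def)

lemma one_Polys [simp]: "1 \<in> Polys V"
  by (metis Const_1 Const_Polys)

lemma add_Polys: "F \<in> Polys V \<Longrightarrow> G \<in> Polys V \<Longrightarrow> F + G \<in> Polys V"
  using keys_add[of F G] by (fastforce simp: Polys_def)

lemma uminus_Polys: "F \<in> Polys V \<Longrightarrow> - F \<in> Polys V"
  by (simp add: Polys_def)

lemma diff_Polys: "F \<in> Polys V \<Longrightarrow> G \<in> Polys V \<Longrightarrow> F - G \<in> Polys V"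
  using add_Polys[of F V "- G"] uminus_Polys[of G V] by simp

lemma mult_Polys:
  assumes "F \<in> Polys V" "G \<in> Polys V"
  shows "F * G \<in> Polys V"
  unfolding Polys_def
proof (intro CollectI ballI)
  fix m assume "m \<in> Poly_Mapping.keys (F * G)"
  then obtain a b where "m = a + b" "a \<in> Poly_Mapping.keys F" "b \<in> Poly_Mapping.keys G"
    using keys_mult[of F G] by blast
  then show "Poly_Mapping.keys m \<subseteq> V"
    using assms keys_add[of a b] by (fastforce simp: Polys_def)
qed

lemma power_Polys: "F \<in> Polys V \<Longrightarrow> F ^ k \<in> Polys V"
  by (induction k) (simp_all add: mult_Polys)

lemma sum_Polys: "(\<And>a. a \<in> A \<Longrightarrow> f a \<in> Polys V) \<Longrightarrow> sum f A \<in> Polys V"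
  by (induction A rule: infinite_finite_induct) (simp_all add: add_Polys)

lemma of_nat_Polys [simp]: "of_nat k \<in> Polys V"
  by (induction k) (simp_all add: add_Polys)

lemma numeral_Polys [simp]: "numeral k \<in> Polys V"
  using of_nat_Polys[of "numeral k" V] by simp

lemma Polys_mono: "V \<subseteq> U \<Longrightarrow> F \<in> Polys V \<Longrightarrow> F \<in> Polys U"
  by (auto simp: Polys_def)

lemmas Polys_intros =
  X_Polys add_Polys uminus_Polys diff_Polys mult_Polys power_Polys sum_Polys

lemma adjoin_power: "a \<in> adjoin R S \<Longrightarrow> a ^ k \<in> adjoin R S"
  by (induction k) (auto intro: adjoin.intros)

lemma adjoin_sum: "(\<And>a. a \<in> A \<Longrightarrow> f a \<in> adjoin R S) \<Longrightarrow> sum f A \<in> adjoin R S"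
  by (induction A rule: infinite_finite_induct) (auto intro: adjoin.intros)

lemma adjoin_prod: "(\<And>a. a \<in> A \<Longrightarrow> f a \<in> adjoin R S) \<Longrightarrow> prod f A \<in> adjoin R S"
  by (induction A rule: infinite_finite_induct) (auto intro: adjoin.intros)

text \<open>Substituting each variable for itself writes F by sums and products of constants and
  variables. This makes induction over \<open>adjoin\<close> available for
  \<open>Polys V\<close>.\<close>

lemma Polys_adjoin:
  assumes "F \<in> Polys V"
  shows "F \<in> adjoin (range Const) (X ` V)"
proof -
  have "peval X F \<in> adjoin (range Const) (X ` V)"
    unfolding peval_def using assms
    by (intro adjoin_sum adjoin.mult adjoin_prod adjoin_power) (auto simp: Polys_def intro: adjoin.intros)
  then show ?thesis by simp
qed

lemma of_nat_mpoly: "of_nat k = (Const (of_nat k) :: ('i, 'a::comm_ring_1) mpoly)"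
  by (induction k) (simp_all add: Const_0 Const_def single_add)

section \<open>Evaluation of univariate polynomials at infinitely many points\<close>

text \<open>In characteristic zero the points z + k w are pairwise distinct, so f - c has infinitely
  many roots in an integral domain.\<close>

lemma constant_on_progression:
  fixes f :: "(nat, 'a::field_char_0) mpoly poly"
  assumes "w \<noteq> 0" "\<And>k::nat. poly f (z + of_nat k * w) = c"
  shows "f = [:c:]"
proof (rule ccontr)
  assume "f \<noteq> [:c:]"
  then have "finite {t. poly (f - [:c:]) t = 0}"
    by (intro poly_roots_finite) simp
  moreover have "range (\<lambda>k::nat. z + of_nat k * w) \<subseteq> {t. poly (f - [:c:]) t = 0}"
    using assms(2) by auto
  ultimately have "finite (range (\<lambda>k::nat. z + of_nat k * w))"
    by (rule rev_finite_subset)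
  moreover have "inj (\<lambda>k::nat. z + of_nat k * w)"
    using assms(1) by (auto intro!: injI)
  ultimately show False by (simp add: finite_image_iff)
qed

lemma map_poly_fixed: "(\<And>i. h (coeff f i) = coeff f i) \<Longrightarrow> h 0 = 0 \<Longrightarrow> map_poly h f = f"
  by (intro poly_eqI) (simp add: coeff_map_poly)

text \<open>The substitution x_i -> x_i + k fixes the coefficients of f and moves the root by k w,
  so one root yields a whole arithmetic progression of roots.\<close>

lemma transcendental_over_Polys:
  fixes w :: "(nat, 'a::field_char_0) mpoly"
  assumes i: "i \<notin> V" and w: "w \<in> Polys V" "w \<noteq> 0" and L: "L \<in> Polys V"
    and f: "\<And>j. coeff f j \<in> Polys V" and z: "poly f (w * X i + L) = 0"
  shows "f = 0"
proof -
  let ?z = "w * X i + L"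
  have "poly f (?z + of_nat k * w) = 0" for k
  proof -
    define h where "h = peval (\<lambda>j. if j = i then X i + of_nat k else (X j :: (nat, 'a) mpoly))"
    have fixed: "h F = F" if "F \<in> Polys V" for F
    proof -
      have "h F = peval X F"
        unfolding h_def using that i by (intro peval_cong[of F V]) auto
      then show ?thesis by simp
    qed
    have "h ?z = h w * (X i + of_nat k) + h L" by (simp add: h_def)
    then have "h ?z = ?z + of_nat k * w"
      by (simp add: fixed w L algebra_simps)
    moreover have "map_poly h f = f"
      by (rule map_poly_fixed) (simp_all add: fixed f)
    moreover have "h (poly f ?z) = poly (map_poly h f) (h ?z)"
      by (simp only: h_def peval_poly)
    ultimately show ?thesis by (metis z fixed zero_Polys)
  qed
  then show ?thesis using constant_on_progression[of w f ?z 0] w by simp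
qed

lemma not_in_Polys:
  fixes w :: "(nat, 'a::field_char_0) mpoly"
  assumes "i \<notin> V" "w \<in> Polys V" "w \<noteq> 0" "L \<in> Polys V"
  shows "w * X i + L \<notin> Polys V"
proof
  assume z: "w * X i + L \<in> Polys V"
  \<comment> \<open>An element z of \<open>Polys V\<close> would be a root of the monic linear
    polynomial T - z over \<open>Polys V\<close>.\<close>
  have "[:- (w * X i + L), 1:] = 0"
  proof (rule transcendental_over_Polys[OF assms])
    show "coeff [:- (w * X i + L), 1:] j \<in> Polys V" for j
      using uminus_Polys[OF z] by (auto simp: coeff_pCons simp del: minus_add_distrib split: nat.split)
  qed simp
  then show False by simp
qed

section \<open>Algebraic independence\<close>

text \<open>The values at z of polynomials with coefficients in \<open>adjoin R S\<close> form a
  ring that contains R, S and z.\<close>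

lemma adjoin_insert_poly:
  assumes "a \<in> adjoin R (insert z S)"
  obtains f where "\<And>j. coeff f j \<in> adjoin R S" "a = poly f z"
proof -
  have const: "\<exists>f. (\<forall>j. coeff f j \<in> adjoin R S) \<and> a = poly f z" if "a \<in> adjoin R S" for a
    using that by (intro exI[of _ "[:a:]"]) (auto simp: coeff_pCons intro: adjoin.zero split: nat.split)
  have "\<exists>f. (\<forall>j. coeff f j \<in> adjoin R S) \<and> a = poly f z"
    using assms
  proof induction
    case (base a)
    then show ?case by (intro const adjoin.base)
  next
    case (gen s)
    then consider "s = z" | "s \<in> S" by blast
    then show ?case
    proof cases
      case 1
      then show ?thesis
        by (intro exI[of _ "[:0, 1:]"])
          (auto simp: coeff_pCons intro: adjoin.zero adjoin.one split: nat.split)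
    qed (intro const adjoin.gen)
  next
    case (uminus a)
    then obtain f where "\<forall>j. coeff f j \<in> adjoin R S" "a = poly f z" by blast
    then show ?case by (intro exI[of _ "- f"]) (simp add: adjoin.uminus)
  next
    case (add a b)
    then obtain f g where "\<forall>j. coeff f j \<in> adjoin R S" "a = poly f z"
      "\<forall>j. coeff g j \<in> adjoin R S" "b = poly g z" by blast
    then show ?case by (intro exI[of _ "f + g"]) (simp add: adjoin.add)
  next
    case (mult a b)
    then obtain f g where "\<forall>j. coeff f j \<in> adjoin R S" "a = poly f z"
      "\<forall>j. coeff g j \<in> adjoin R S" "b = poly g z" by blast
    then show ?case
      by (intro exI[of _ "f * g"]) (simp add: coeff_mult adjoin_sum adjoin.mult)
  qed (intro const adjoin.intros)+
  then show ?thesis using that by blast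
qed

lemma adjoin_Polys: "S \<subseteq> Polys V \<Longrightarrow> adjoin (range Const) S \<subseteq> Polys V"
proof
  fix a assume "a \<in> adjoin (range Const) S" "S \<subseteq> Polys V"
  then show "a \<in> Polys V" by induction (auto intro: Polys_intros)
qed

lemma Polys_insert_poly:
  assumes "F \<in> Polys (insert z S)"
  obtains f where "\<And>j. coeff f j \<in> Polys S" "F = poly f (X z)"
proof -
  have "F \<in> adjoin (range Const) (insert (X z) (X ` S))"
    using Polys_adjoin[OF assms] by simp
  then obtain f where "\<And>j. coeff f j \<in> adjoin (range Const) (X ` S)" "F = poly f (X z)"
    using adjoin_insert_poly by blast
  moreover have "adjoin (range Const) (X ` S) \<subseteq> Polys S"
    by (intro adjoin_Polys) (auto intro: X_Polys)
  ultimately show ?thesis using that by blast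
qed

lemma peval_in_Polys:
  assumes "F \<in> Polys S" "\<And>s. s \<in> S \<Longrightarrow> f s \<in> Polys V"
  shows "peval f F \<in> Polys V"
  using Polys_adjoin[OF assms(1)]
  by induction (auto intro: assms(2) Polys_intros)

lemma alg_independent_empty: "alg_independent ({} :: ('i, 'a::comm_ring_1) mpoly set)"
proof -
  have "F = 0" if "F \<in> Polys {}" "peval (\<lambda>s. s) F = 0"
    for F :: "(('i, 'a) mpoly, 'a) mpoly"
  proof -
    have "Poly_Mapping.keys F \<subseteq> {0}"
      using that(1) by (auto simp: Polys_def)
    then have "F = Const (Poly_Mapping.lookup F 0)"
      by (intro poly_mapping_eqI)
        (auto simp: Const_def lookup_single when_def not_in_keys_iff_lookup_eq_zero[symmetric])
    \<comment> \<open>F and its value lie in different polynomial rings, but both are the constant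
      with the same scalar.\<close>
    moreover then have "Const (Poly_Mapping.lookup F 0) = (0 :: ('i, 'a) mpoly)"
      by (metis peval_Const that(2))
    ultimately show ?thesis
      by (metis Const_0 Const_def lookup_single_eq lookup_zero)
  qed
  then show ?thesis by (auto simp: alg_independent_def)
qed

text \<open>Read a relation as a polynomial f in the new variable. Evaluating its coefficients at S
  gives a polynomial over \<open>Polys V\<close> with root w x_i + L, hence zero; independence of S
  then kills every coefficient of f.\<close>

lemma alg_independent_insert:
  fixes w :: "(nat, 'a::field_char_0) mpoly"
  assumes S: "alg_independent S" "S \<subseteq> Polys V"
    and z: "i \<notin> V" "w \<in> Polys V" "w \<noteq> 0" "L \<in> Polys V"
  shows "alg_independent (insert (w * X i + L) S)"
  unfolding alg_independent_def
proof (intro allI impI)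
  fix F assume F: "F \<in> Polys (insert (w * X i + L) S)" and 0: "peval (\<lambda>s. s) F = 0"
  obtain f where f: "\<And>j. coeff f j \<in> Polys S" "F = poly f (X (w * X i + L))"
    using Polys_insert_poly[OF F] by blast
  have "map_poly (peval (\<lambda>s. s)) f = 0"
  proof (rule transcendental_over_Polys[OF z])
    show "coeff (map_poly (peval (\<lambda>s. s)) f) j \<in> Polys V" for j
      using f(1) S(2) by (auto simp: coeff_map_poly intro!: peval_in_Polys)
    show "poly (map_poly (peval (\<lambda>s. s)) f) (w * X i + L) = 0"
      using 0 by (simp add: f(2) peval_poly)
  qed
  then have "peval (\<lambda>s. s) (coeff f j) = 0" for j
    by (metis coeff_0 coeff_map_poly peval_0)
  then have "coeff f j = 0" for j
    using S(1) f(1) unfolding alg_independent_def by blast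
  then have "f = 0" by (intro poly_eqI) simp
  then show "F = 0" by (simp add: f(2))
qed

section \<open>Homogeneous polynomials\<close>

definition mdeg :: "('i \<Rightarrow>\<^sub>0 nat) \<Rightarrow> nat" where
  "mdeg m = (\<Sum>i\<in>Poly_Mapping.keys m. Poly_Mapping.lookup m i)"

text \<open>Zero is homogeneous of every degree, so cancellation in sums needs no care; nonvanishing
  enters only when the total degree is read off.\<close>

definition homogeneous :: "nat \<Rightarrow> ('i, 'a::comm_ring_1) mpoly \<Rightarrow> bool" where
  "homogeneous d F \<longleftrightarrow> (\<forall>m\<in>Poly_Mapping.keys F. mdeg m = d)"

lemma mdeg_add: "mdeg (a + b) = mdeg a + mdeg b"
proof -
  let ?A = "Poly_Mapping.keys a \<union> Poly_Mapping.keys b"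
  have *: "mdeg l = (\<Sum>i\<in>?A. Poly_Mapping.lookup l i)" if "Poly_Mapping.keys l \<subseteq> ?A" for l
    unfolding mdeg_def using that
    by (intro sum.mono_neutral_left) (simp_all add: not_in_keys_iff_lookup_eq_zero)
  show ?thesis
    by (simp add: *[OF keys_add] *[OF Un_upper1] *[OF Un_upper2] lookup_add sum.distrib)
qed

lemma homogeneous_X: "homogeneous 1 (X i)"
  by (simp add: homogeneous_def X_def mdeg_def)

lemma homogeneous_of_nat: "homogeneous 0 (of_nat k)"
  unfolding homogeneous_def of_nat_mpoly by (simp add: Const_def mdeg_def del: single_of_nat)

lemma homogeneous_uminus: "homogeneous d F \<Longrightarrow> homogeneous d (- F)"
  by (simp add: homogeneous_def)

lemma homogeneous_add: "homogeneous d F \<Longrightarrow> homogeneous d G \<Longrightarrow> homogeneous d (F + G)"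
  using keys_add[of F G] by (fastforce simp: homogeneous_def)

lemma homogeneous_diff: "homogeneous d F \<Longrightarrow> homogeneous d G \<Longrightarrow> homogeneous d (F - G)"
  using homogeneous_add[of d F "- G"] homogeneous_uminus[of d G] by simp

lemma homogeneous_mult:
  assumes "homogeneous d F" "homogeneous e G" "d + e = n"
  shows "homogeneous n (F * G)"
  unfolding homogeneous_def
proof
  fix m assume "m \<in> Poly_Mapping.keys (F * G)"
  then obtain a b where "m = a + b" "a \<in> Poly_Mapping.keys F" "b \<in> Poly_Mapping.keys G"
    using keys_mult[of F G] by blast
  then show "mdeg m = n" using assms by (simp add: homogeneous_def mdeg_add)
qed

lemma homogeneous_sum:
  "(\<And>a. a \<in> A \<Longrightarrow> homogeneous d (f a)) \<Longrightarrow> homogeneous d (sum f A)"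
  by (induction A rule: infinite_finite_induct)
    (simp_all add: homogeneous_add, simp_all add: homogeneous_def)

lemma total_degree_homogeneous:
  assumes "homogeneous d F" "F \<noteq> 0"
  shows "total_degree F = d"
proof -
  have "Poly_Mapping.keys F \<noteq> {}" using assms(2) by simp
  then have "mdeg ` Poly_Mapping.keys F = {d}"
    using assms(1) by (auto simp: homogeneous_def image_iff ex_in_conv simp del: keys_eq_empty)
  then show ?thesis
    by (simp add: total_degree_def mdeg_def[abs_def])
qed

section \<open>Invariance of the explicit polynomials\<close>

text \<open>
  On the sequence \<open>x\<^sub>1, x\<^sub>2, \<dots>\<close> the map \<open>sigma\<close> is \<open>1 + E\<inverse>\<close> for the shift operator \<open>E\<close>;
  \<open>W l j\<close> is \<open>(1 + E)\<^sup>l\<close> applied to \<open>x\<^bsub>j+1\<^esub>\<close>, so \<open>sigma\<close> moves \<open>W l (j + 1)\<close> to \<open>W (l + 1) j\<close>.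
\<close>

fun W :: "nat \<Rightarrow> nat \<Rightarrow> (nat, 'a::comm_ring_1) mpoly" where
  "W 0 j = X (Suc j)"
| "W (Suc l) j = W l j + W l (Suc j)"

lemma sigma_W: "sigma (W l (Suc j)) = W (Suc l) j"
  by (induction l arbitrary: j) (simp_all add: sigma_X sigma_add)

text \<open>The term E^l of (1 + E)^l has coefficient 1 and alone reaches the highest variable. The
  leading terms of the generators come from here.\<close>

lemma W_top: "(W l j :: (nat, 'a::comm_ring_1) mpoly) - X (Suc (j + l)) \<in> Polys {1..j + l}"
proof (induction l arbitrary: j)
  case (Suc l)
  have "((W l j :: (nat, 'a) mpoly) - X (Suc (j + l))) + X (Suc (j + l)) + (W l (Suc j) - X (Suc (Suc j + l)))
      \<in> PolyAlg (j + Suc l)"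
    using Suc[of "Suc j"] Polys_mono[OF _ Suc[of j], of "{1..j + Suc l}"]
    by (intro add_Polys X_Polys) simp_all
  then show ?case by (simp add: add_diff_eq)
qed simp

lemma W_Polys: "j + l < N \<Longrightarrow> W l j \<in> Polys {1..N}"
  using add_Polys[of "W l j - X (Suc (j + l))" "{1..N}" "X (Suc (j + l))"]
    Polys_mono[OF _ W_top[of l j], of "{1..N}"] by (simp add: X_Polys)

lemma homogeneous_W: "homogeneous 1 (W l j)"
  by (induction l arbitrary: j) (simp_all add: homogeneous_X[simplified] homogeneous_add)

section \<open>The coefficients of \<open>p k\<close> and \<open>q k\<close> in terms of powers of 1
  + E\<close>

lemma binom_int: "binom (int a) (int b) = int (a choose b)"
  by (simp add: binom_def binomial_eq_0)

text \<open>Pascal's rule at every integer t. The upper index on the left has to be positive: with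
  this convention the rule fails at upper index 0.\<close>

lemma binom_Suc: "binom (int (Suc l)) t = binom (int l) t + binom (int l) (t - 1)"
proof (cases "t \<le> 0")
  case True
  then show ?thesis by (cases "t = 0") (auto simp: binom_def)
next
  case False
  then obtain s where t: "t = int (Suc s)" by (metis not_le pos_int_cases gr0_implies_Suc)
  then have "t - 1 = int s" by simp
  then show ?thesis by (simp only: t binom_int) simp
qed

text \<open>The binomial expansion of (1 + E)^l E^d. The bound N only has to be large enough, so
  expansions with different l and d share one summation range.\<close>

lemma W_binom:
  "l + d \<le> N \<Longrightarrow>
     (\<Sum>s = 0..N. of_int (binom (int l) (int s - int d)) * X (Suc (j + s))) = W l (j + d)"
proof (induction l arbitrary: d)
  case 0
  have "(\<Sum>s = 0..N. of_int (binom (int 0) (int s - int d)) * X (Suc (j + s))) =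
      (\<Sum>s = 0..N. if s = d then X (Suc (j + s)) else (0 :: (nat, 'a) mpoly))"
    by (intro sum.cong) (auto simp: binom_def)
  then show ?case using 0 by (simp add: sum.delta)
next
  case (Suc l)
  have "int s - int d - 1 = int s - int (Suc d)" for s by simp
  then show ?case
    using Suc.IH[of d] Suc.IH[of "Suc d"] Suc.prems
    by (simp only: binom_Suc of_int_add distrib_right sum.distrib) simp
qed

text \<open>This is (1 + E)^l (1 + 2E) applied to x_{k+1}; likewise \<open>gW k l\<close> is (1 +
  E)^l ((l+2) E + (2l+3) E^2) applied to x_{k+1}. Up to sign they are the inner sums with
  coefficients \<open>lam\<close> and \<open>alpha\<close> for i = k - 1 - l.\<close>

definition pW :: "nat \<Rightarrow> nat \<Rightarrow> (nat, 'a::comm_ring_1) mpoly" where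
  "pW k l = W l k + 2 * W l (Suc k)"

definition gW :: "nat \<Rightarrow> nat \<Rightarrow> (nat, 'a::comm_ring_1) mpoly" where
  "gW k l = of_nat (l + 2) * W l (Suc k) + of_nat (2 * l + 3) * W l (Suc (Suc k))"

text \<open>Up to a multiple of \<open>p k\<close>, \<open>g k\<close> is the bracket of \<open>q k = - x\<^sub>2 * p k + x\<^sub>1 * (\<dots>)\<close>.\<close>

definition g :: "nat \<Rightarrow> (nat, 'a::comm_ring_1) mpoly" where
  "g k = X (Suc k) * X (Suc (Suc k)) + (\<Sum>l<k. (-1) ^ Suc l * X (k - l) * gW k l)"

lemma lam_W:
  assumes "i + l + 1 = k"
  shows "(\<Sum>j = k..2 * k - i. of_int (lam k i j) * X (j + 1)) = (-1) ^ Suc l * pW k l"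
proof -
  have "(\<Sum>j = k..2 * k - i. of_int (lam k i j) * X (j + 1)) =
      (\<Sum>s = 0..Suc l. of_int (lam k i (k + s)) * X (Suc (k + s)))"
    using assms by (intro sum.reindex_bij_witness[of _ "\<lambda>s. k + s" "\<lambda>j. j - k"]) auto
  also have "\<dots> = (\<Sum>s = 0..Suc l. (-1) ^ Suc l *
      (of_int (binom (int (Suc l)) (int s - int 0)) * X (Suc (k + s)) +
       of_int (binom (int l) (int s - int 1)) * X (Suc (k + s))))"
  proof (intro sum.cong refl)
    fix s
    have "k - i = Suc l" "int k - int i = int (Suc l)" "int k - int i - 1 = int l"
      using assms by auto
    then show "of_int (lam k i (k + s)) * X (Suc (k + s)) = (-1) ^ Suc l *
      (of_int (binom (int (Suc l)) (int s - int 0)) * X (Suc (k + s)) +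
       of_int (binom (int l) (int s - int 1)) * X (Suc (k + s)))"
      by (simp add: lam_def algebra_simps)
  qed
  also have "\<dots> = (-1) ^ Suc l * (W (Suc l) (k + 0) + W l (k + 1))"
    unfolding sum_distrib_left[symmetric] sum.distrib by (subst (1 2) W_binom) simp_all
  finally show ?thesis by (simp add: pW_def algebra_simps)
qed

lemma alpha_W:
  assumes "i + l + 1 = k"
  shows "(\<Sum>j = k + 1..2 * k - i + 1. of_int (alpha k i j) * X (j + 1)) = (-1) ^ Suc l * gW k l"
proof -
  let ?b = "\<lambda>l d s. of_int (binom (int l) (int s - int d)) * (X (Suc (k + s)) :: (nat, 'a) mpoly)"
  have kl: "k - i = Suc l" "int k - int i = int (Suc l)" "int k - int i - 1 = int l"
    using assms by auto
  \<comment> \<open>The sum may therefore start at j = k, which becomes s = 0 in the expansion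
    below.\<close>
  have "alpha k i k = 0" by (simp add: alpha_def binom_def)
  then have "(\<Sum>j = k + 1..2 * k - i + 1. of_int (alpha k i j) * X (j + 1)) =
      (\<Sum>j = k..2 * k - i + 1. of_int (alpha k i j) * (X (j + 1) :: (nat, 'a) mpoly))"
    using assms by (subst (2) sum.atLeast_Suc_atMost) simp_all
  also have "\<dots> = (\<Sum>s = 0..l + 2. of_int (alpha k i (k + s)) * X (Suc (k + s)))"
    using assms by (intro sum.reindex_bij_witness[of _ "\<lambda>s. k + s" "\<lambda>j. j - k"]) auto
  also have "\<dots> = (\<Sum>s = 0..l + 2. (-1) ^ Suc l *
      (2 * ?b l 1 s + 3 * ?b l 2 s + of_nat l * (?b (Suc l) 1 s + ?b l 2 s)))"
    by (intro sum.cong refl) (simp add: kl alpha_def algebra_simps)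
  also have "\<dots> = (-1) ^ Suc l *
      (2 * W l (k + 1) + 3 * W l (k + 2) + of_nat l * (W (Suc l) (k + 1) + W l (k + 2)))"
    unfolding sum_distrib_left[symmetric] sum.distrib
    by (subst (1 2 3 4) W_binom) simp_all
  finally show ?thesis by (simp add: gW_def algebra_simps)
qed

text \<open>Makes the x_1 part of \<open>p k\<close> the missing row i = 0 of its double
  sum.\<close>

lemma mu_lam: "mu k j = - lam k 0 j" if "k \<ge> 1"
  using that by (cases k) (simp_all add: mu_def lam_def)

text \<open>Makes the x_1^2 part of \<open>q k\<close> the missing row i = 0. As k >= 2, Pascal's
  rule reduces all binomials to upper index k - 2, where the two sides agree term by term.\<close>

lemma beta_alpha:
  assumes "k \<ge> 2" "j \<ge> 1"
  shows "beta k j = - alpha k 0 j"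
proof -
  obtain c where k: "k = Suc (Suc c)"
    using assms(1) by (metis add_2_eq_Suc le_Suc_ex)
  define t where "t = int j - int k"
  have j: "int (j - 1) = int j - 1" using assms(2) by simp
  have b: "binom (int c + 1) u = binom (int c) u + binom (int c) (u - 1)"
    "binom (int c + 2) u = binom (int c + 1) u + binom (int c + 1) (u - 1)" for u
    using binom_Suc[of c u] binom_Suc[of "Suc c" u] by (simp_all add: algebra_simps)
  have e: "int k = int c + 2" "k - 0 = Suc (Suc c)" "k - 1 = Suc c" by (simp_all add: k)
  have c: "int c + 2 - int 0 = int c + 2" "int c + 2 - int 1 = int c + 1"
    "int c + 2 - 1 = int c + 1" "int c + 1 - 1 = int c" by simp_all
  have t: "int j - int k - 1 = t - 1" "int j - int k - 2 = t - 2" "int j - 1 - int k = t - 1"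
    by (simp_all add: t_def)
  have t3: "t - 1 - 1 = t - 2" "t - 2 - 1 = t - 3" "t - 1 - 2 = t - 3" by simp_all
  show ?thesis
    unfolding beta_def alpha_def mu_def j t unfolding e c
    by (simp only: b t3) (simp add: algebra_simps)
qed

lemma p_W:
  assumes "k \<ge> 1"
  shows "p k = X (Suc k) ^ 2 + (\<Sum>l<k. (-1) ^ Suc l * X (k - l) * pW k l)"
proof -
  let ?f = "\<lambda>i. X (i + 1) * (\<Sum>j = k..2 * k - i. of_int (lam k i j) * (X (j + 1) :: (nat, 'a) mpoly))"
  have "p k = X (k + 1) ^ 2 + sum ?f {1..k - 1} + ?f 0"
    unfolding p_def using assms
    by (simp add: mu_lam sum_distrib_left sum_negf mult_ac)
  also have "sum ?f {1..k - 1} + ?f 0 = sum ?f {0..k - 1}"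
    by (subst sum.atLeast_Suc_atMost[of 0 "k - 1" ?f]) (simp_all only: le0 One_nat_def add.commute)
  then have "X (k + 1) ^ 2 + sum ?f {1..k - 1} + ?f 0 = X (k + 1) ^ 2 + sum ?f {0..k - 1}"
    by (simp only: add.assoc)
  \<comment> \<open>The rows are numbered backwards by l = k - 1 - i, so that l is the exponent of 1
    + E.\<close>
  also have "sum ?f {0..k - 1} = (\<Sum>l<k. X (k - l) * ((-1) ^ Suc l * pW k l))"
  proof (rule sum.reindex_bij_witness[of _ "\<lambda>l. k - 1 - l" "\<lambda>i. k - 1 - i"])
    fix i assume "i \<in> {0..k - 1}"
    then have "i + (k - 1 - i) + 1 = k" "k - (k - 1 - i) = i + 1" using assms by auto
    then show "X (k - (k - 1 - i)) * ((-1) ^ Suc (k - 1 - i) * pW k (k - 1 - i)) = ?f i"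
      by (simp only: lam_W)
  qed (use assms in auto)
  finally show ?thesis by (simp add: mult_ac)
qed

text \<open>The explicit \<open>q 1\<close> differs from the uniform formula by - x_1 p_1, which is
  itself invariant.\<close>

lemma q_W:
  assumes "k \<ge> 1"
  shows "q k = - X 2 * p k + X 1 * (g k - (if k = 1 then p k else 0))"
proof (cases "k = 1")
  case True
  have mu: "mu 1 1 = 1" "mu 1 2 = 2" by (simp_all add: mu_def binom_def)
  have "{1..2::nat} = {1, 2}" by auto
  then have p: "p 1 = X 2 * X 2 - X 1 * (X 2 + 2 * X 3)"
    using mu by (simp add: p_def power2_eq_square numeral_2_eq_2 numeral_3_eq_3)
  have g: "g 1 = X 2 * X 3 - X 1 * (2 * X 3 + 3 * X 4)"
    by (simp add: g_def gW_def numeral_eq_Suc)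
  show ?thesis
    unfolding True p g by (simp add: q_def algebra_simps power2_eq_square power3_eq_cube)
next
  case False
  let ?f = "\<lambda>i. X (i + 1) *
    (\<Sum>j = k + 1..2 * k - i + 1. of_int (alpha k i j) * (X (j + 1) :: (nat, 'a) mpoly))"
  have "(\<Sum>i = k + 1..2 * k + 1. of_int (beta k i) * (X (i + 1) :: (nat, 'a) mpoly)) =
      (\<Sum>i = k + 1..2 * k + 1. - (of_int (alpha k 0 i) * X (i + 1)))"
    using False assms by (intro sum.cong refl) (simp add: beta_alpha)
  then have "q k = - X 2 * p k + X 1 * X (k + 1) * X (k + 2) + X 1 * sum ?f {1..k - 1} + X 1 * ?f 0"
    unfolding q_def using False
    by (simp add: sum_negf sum_distrib_left mult_ac power2_eq_square del: sum.cl_ivl_Suc)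
  also have "X 1 * sum ?f {1..k - 1} + X 1 * ?f 0 = X 1 * sum ?f {0..k - 1}"
    by (subst sum.atLeast_Suc_atMost[of 0 "k - 1" ?f])
      (simp_all only: le0 One_nat_def add.commute distrib_left)
  then have "- X 2 * p k + X 1 * X (k + 1) * X (k + 2) + X 1 * sum ?f {1..k - 1} + X 1 * ?f 0 =
      - X 2 * p k + X 1 * X (k + 1) * X (k + 2) + X 1 * sum ?f {0..k - 1}"
    by (simp only: add.assoc)
  also have "sum ?f {0..k - 1} = (\<Sum>l<k. X (k - l) * ((-1) ^ Suc l * gW k l))"
  proof (rule sum.reindex_bij_witness[of _ "\<lambda>l. k - 1 - l" "\<lambda>i. k - 1 - i"])
    fix i assume "i \<in> {0..k - 1}"
    then have "i + (k - 1 - i) + 1 = k" "k - (k - 1 - i) = i + 1" using assms by auto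
    then show "X (k - (k - 1 - i)) * ((-1) ^ Suc (k - 1 - i) * gW k (k - 1 - i)) = ?f i"
      by (simp only: alpha_W)
  qed (use assms in auto)
  finally show ?thesis using False by (simp add: g_def algebra_simps)
qed

text \<open>With T l = u l (B' l - B l), the recurrence gives u (l+1) B' l = T (l+1), so the summand
  is (-1)^(l+1) (T l + T (l+1)).\<close>

lemma alternating_telescope:
  fixes u B B' :: "nat \<Rightarrow> 'b::comm_ring_1"
  assumes "\<And>l. B' (Suc l) = B' l + B (Suc l)"
  shows "(\<Sum>l<n. (-1) ^ Suc l * ((u l + u (Suc l)) * B' l - u l * B l)) =
    (-1) ^ n * u n * (B' n - B n) - u 0 * (B' 0 - B 0)"
  by (induction n) (simp_all add: assms algebra_simps)

lemma sigma_uminus: "sigma (- F) = - sigma F"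
  and sigma_diff: "sigma (F - G) = sigma F - sigma G"
  and sigma_power: "sigma (F ^ k) = sigma F ^ k"
  and sigma_sum: "sigma (sum f A) = (\<Sum>a\<in>A. sigma (f a))"
  and sigma_0: "sigma 0 = 0"
  and sigma_1: "sigma 1 = 1"
  and sigma_of_nat: "sigma (of_nat c) = of_nat c"
  and sigma_numeral: "sigma (numeral w) = numeral w"
  by (simp_all add: sigma_def peval_sum)

lemmas sigma_simps = sigma_add sigma_mult sigma_uminus sigma_diff sigma_power sigma_0 sigma_1
  sigma_of_nat sigma_numeral

text \<open>The defect D measures how far B is from telescoping exactly: B + D telescopes, and the
  alternating sum of D remains. It is zero for \<open>p k\<close> and \<open>pW k\<close> for
  \<open>g k\<close>.\<close>

lemma sigma_alternating_sum:
  fixes B B' :: "nat \<Rightarrow> (nat, 'a::comm_ring_1) mpoly"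
  assumes k: "k \<ge> 1" and B: "\<And>l. sigma (B l) = B' l"
    and D: "\<And>l. B' (Suc l) = B' l + B (Suc l) + D (Suc l)"
  shows "sigma (\<Sum>l<k. (-1) ^ Suc l * X (k - l) * B l) =
    (\<Sum>l<k. (-1) ^ Suc l * X (k - l) * B l) + (\<Sum>l<k. (-1) ^ Suc l * X (k - l) * D l)
      - X k * (B' 0 - B 0 - D 0)"
proof -
  \<comment> \<open>Cutting off at l = k accounts for sigma fixing x_1 = u (k - 1), and it removes
    the upper boundary term.\<close>
  define u :: "nat \<Rightarrow> (nat, 'a) mpoly" where "u l = (if l < k then X (k - l) else 0)" for l
  have u: "sigma (u l) = u l + u (Suc l)" if "l < k" for l
    using that by (auto simp: u_def sigma_X)
  have X: "X (k - l) = u l" if "l \<in> {..<k}" for l using that by (simp add: u_def)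
  have sum: "(\<Sum>l<k. (-1) ^ Suc l * X (k - l) * F l) = (\<Sum>l<k. (-1) ^ Suc l * u l * F l)" for F
    by (intro sum.cong refl) (simp add: X)
  have "sigma (\<Sum>l<k. (-1) ^ Suc l * u l * B l) - (\<Sum>l<k. (-1) ^ Suc l * u l * B l)
      - (\<Sum>l<k. (-1) ^ Suc l * u l * D l)
    = (\<Sum>l<k. (-1) ^ Suc l * ((u l + u (Suc l)) * B' l - u l * (B l + D l)))"
    by (simp add: sigma_sum sigma_simps u B algebra_simps flip: sum_subtractf sum.distrib)
  also have "\<dots> = (-1) ^ k * u k * (B' k - (B k + D k)) - u 0 * (B' 0 - (B 0 + D 0))"
    by (rule alternating_telescope) (simp add: D)
  also have "\<dots> = - X k * (B' 0 - B 0 - D 0)"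
    using k by (simp add: u_def diff_diff_eq)
  finally show ?thesis unfolding sum by (simp add: algebra_simps)
qed

text \<open>The boundary term is - x_k (x_k + 2 x_{k+1}), which cancels the increment of
  x_{k+1}^2.\<close>

lemma sigma_p:
  assumes "k \<ge> 1"
  shows "sigma (p k) = p k"
proof -
  obtain c where k: "k = Suc c" using assms by (cases k) auto
  have "sigma (\<Sum>l<k. (-1) ^ Suc l * X (k - l) * pW k l) =
      (\<Sum>l<k. (-1) ^ Suc l * X (k - l) * pW k l) + (\<Sum>l<k. (-1) ^ Suc l * X (k - l) * 0)
      - X k * ((W 1 c + 2 * W 1 k) - pW k 0 - (0 :: (nat, 'a) mpoly))"
    by (rule sigma_alternating_sum[where B' = "\<lambda>l. W (Suc l) c + 2 * W (Suc l) k" and D = "\<lambda>_. 0",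
          simplified One_nat_def[symmetric]])
      (simp_all add: k pW_def sigma_simps sigma_W algebra_simps)
  then show ?thesis
    unfolding p_W[OF assms] by (simp add: k pW_def sigma_simps sigma_X algebra_simps power2_eq_square)
qed

text \<open>The coefficients l + 2 and 2l + 3 of \<open>gW\<close> grow by 1 and 2 with l, which
  produces the defect \<open>pW\<close>. The boundary term - x_k (x_{k+1} + x_{k+2}) reduces the
  increment of x_{k+1} x_{k+2} to x_{k+1}^2, the square in \<open>p k\<close>.\<close>

lemma sigma_g:
  assumes "k \<ge> 1"
  shows "sigma (g k) = g k + p k"
proof -
  obtain c where k: "k = Suc c" using assms by (cases k) auto
  have "sigma (\<Sum>l<k. (-1) ^ Suc l * X (k - l) * gW k l) =
      (\<Sum>l<k. (-1) ^ Suc l * X (k - l) * gW k l) + (\<Sum>l<k. (-1) ^ Suc l * X (k - l) * pW k l)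
      - X k * ((of_nat (0 + 2) * W 1 k + of_nat (2 * 0 + 3) * W 1 (Suc k)) - gW k 0
        - (pW k 0 :: (nat, 'a) mpoly))"
    by (rule sigma_alternating_sum[where
          B' = "\<lambda>l. of_nat (l + 2) * W (Suc l) k + of_nat (2 * l + 3) * W (Suc l) (Suc k)",
          simplified One_nat_def[symmetric]])
      (simp_all add: k gW_def pW_def sigma_simps sigma_W algebra_simps)
  then show ?thesis
    unfolding p_W[OF assms] g_def
    by (simp add: k pW_def gW_def sigma_simps sigma_X algebra_simps power2_eq_square)
qed

lemma sigma_q: "k \<ge> 1 \<Longrightarrow> sigma (q k) = q k"
  by (auto simp: q_W sigma_simps sigma_X sigma_p sigma_g algebra_simps)

section \<open>The triangular form of the generators\<close>

lemma Const_power: "Const (c ^ k) = Const c ^ k"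
  by (induction k) (simp_all add: Const_1 Const_mult)

lemma Const_sign_of_nat: "Const ((-1) ^ k * of_nat c) = (-1) ^ k * of_nat c"
  by (simp add: Const_mult Const_power Const_uminus Const_1 flip: of_nat_mpoly)

text \<open>The leading coefficient is a unit once x_1 is inverted, so F can then replace x_{N+1} as
  a generator.\<close>

definition triangular :: "nat \<Rightarrow> (nat, 'a::field_char_0) mpoly \<Rightarrow> bool" where
  "triangular N F \<longleftrightarrow>
     (\<exists>c e L. c \<noteq> 0 \<and> L \<in> PolyAlg N \<and> F = Const c * X 1 ^ e * X (Suc N) + L)"

lemma triangularI:
  "c \<noteq> 0 \<Longrightarrow> L \<in> PolyAlg N \<Longrightarrow> F = Const c * X 1 ^ e * X (Suc N) + L \<Longrightarrow> triangular N F"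
  by (auto simp: triangular_def)

lemma triangular_p:
  assumes "k \<ge> 1"
  shows "triangular (2 * k) (p k :: (nat, 'a::field_char_0) mpoly)"
proof -
  obtain c where k: "k = Suc c" using assms by (cases k) auto
  \<comment> \<open>The variable x_{2k+1} occurs only in the summand l = c = k - 1, whose outer
    factor is x_1.\<close>
  let ?T = "X (Suc (Suc k + c)) :: (nat, 'a) mpoly"
  define d where "d = W c (Suc k) - ?T"
  let ?L = "X (Suc k) ^ 2 + (\<Sum>l<c. (-1) ^ Suc l * X (k - l) * pW k l)
    + (-1) ^ k * X 1 * (W c k + 2 * d)"
  have nonzero: "(-1) ^ k * of_nat 2 \<noteq> (0::'a)" by simp
  have "d \<in> PolyAlg (2 * k)"
    using W_top[of c "Suc k"] by (simp add: d_def k mult_2)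
  then have L: "?L \<in> PolyAlg (2 * k)"
    by (intro Polys_intros one_Polys numeral_Polys)
      (auto simp: k pW_def simp del: One_nat_def intro!: Polys_intros W_Polys)
  have W: "W c (Suc k) = ?T + d" by (simp add: d_def)
  have "p k = X (Suc k) ^ 2 + (\<Sum>l<c. (-1) ^ Suc l * X (k - l) * pW k l)
      + (-1) ^ k * X 1 * pW k c"
    unfolding p_W[OF assms] by (simp add: k)
  also have "\<dots> = (-1) ^ k * of_nat 2 * X 1 ^ 1 * ?T + ?L"
    unfolding pW_def[of k c] W by (simp add: algebra_simps)
  also have "Suc k + c = 2 * k" by (simp add: k)
  finally show ?thesis
    by (intro triangularI[OF nonzero L, of _ 1]) (simp only: Const_sign_of_nat)
qed

lemma triangular_Polys: "triangular N F \<Longrightarrow> N \<ge> 1 \<Longrightarrow> N < M \<Longrightarrow> F \<in> PolyAlg M"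
  by (auto simp: triangular_def simp del: One_nat_def intro!: Polys_intros
      intro: Polys_mono[of "{1..N}", rotated])

lemma triangular_q:
  assumes "k \<ge> 1"
  shows "triangular (2 * k + 1) (q k :: (nat, 'a::field_char_0) mpoly)"
proof -
  obtain c where k: "k = Suc c" using assms by (cases k) auto
  let ?T = "X (Suc (Suc (Suc k) + c)) :: (nat, 'a) mpoly"
  \<comment> \<open>\<open>D\<close> is 2k + 1, the coefficient of the top variable x_{2k+2} in
    \<open>gW k c\<close>. One factor x_1 comes from \<open>q_W\<close> and one from the last
    summand of \<open>g k\<close>; \<open>p k\<close> stays below x_{2k+2}.\<close>
  define D :: "(nat, 'a) mpoly" where "D = of_nat (2 * c + 3)"
  define d where "d = W c (Suc (Suc k)) - ?T"
  define M where "M = X (Suc k) * X (Suc (Suc k)) + (\<Sum>l<c. (-1) ^ Suc l * X (k - l) * gW k l)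
    + (-1) ^ k * X 1 * (of_nat (c + 2) * W c (Suc k) + D * d)"
  let ?L = "- X 2 * p k + X 1 * (M - (if k = 1 then p k else 0))"
  have nonzero: "(-1) ^ k * of_nat (2 * c + 3) \<noteq> (0::'a)"
    using of_nat_eq_0_iff[of "2 * c + 3", where 'a = 'a] by (simp del: of_nat_add of_nat_mult)
  have p: "(p k :: (nat, 'a) mpoly) \<in> PolyAlg (2 * k + 1)"
    using triangular_p[OF assms] by (rule triangular_Polys) (use assms in auto)
  have "d \<in> PolyAlg (2 * k + 1)"
    using W_top[of c "Suc (Suc k)"] by (simp add: d_def k mult_2)
  then have "M \<in> PolyAlg (2 * k + 1)"
    unfolding M_def by (intro Polys_intros one_Polys of_nat_Polys)
      (auto simp: k gW_def D_def simp del: of_nat_Suc of_nat_add of_nat_mult One_nat_def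
        intro!: Polys_intros W_Polys of_nat_Polys)
  then have L: "?L \<in> PolyAlg (2 * k + 1)"
    using p assms by (intro Polys_intros) auto
  have W: "W c (Suc (Suc k)) = ?T + d" by (simp add: d_def)
  have "g k = X (Suc k) * X (Suc (Suc k)) + (\<Sum>l<c. (-1) ^ Suc l * X (k - l) * gW k l)
      + (-1) ^ k * X 1 * gW k c"
    unfolding g_def by (simp add: k)
  also have "\<dots> = (-1) ^ k * X 1 * D * ?T + M"
    unfolding M_def gW_def[of k c] W D_def[symmetric] by (simp add: algebra_simps)
  finally have "q k = (-1) ^ k * D * X 1 ^ 2 * ?T + ?L"
    unfolding q_W[OF assms] by (simp add: algebra_simps power2_eq_square)
  moreover have "Suc (Suc k) + c = 2 * k + 1" by (simp add: k)
  ultimately show ?thesis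
    by (intro triangularI[OF nonzero L, of _ 2]) (simp only: Const_sign_of_nat D_def)
qed

text \<open>The order p_1, q_1, p_2, q_2, ... makes x_{t+2} the new variable of
  \<open>pq t\<close>.\<close>

definition pq :: "nat \<Rightarrow> (nat, 'a::comm_ring_1) mpoly" where
  "pq t = (if odd t then p (Suc t div 2) else q (t div 2))"

lemma triangular_pq: "t \<ge> 1 \<Longrightarrow> triangular (Suc t) (pq t)"
  using triangular_p[of "Suc t div 2"] triangular_q[of "t div 2"]
  by (auto simp: pq_def elim!: oddE evenE)

lemma sigma_pq: "t \<ge> 1 \<Longrightarrow> sigma (pq t) = pq t"
  by (auto simp: pq_def sigma_p sigma_q elim!: oddE evenE)

lemma Const_X_power_Polys: "N \<ge> 1 \<Longrightarrow> Const c * X 1 ^ e \<in> PolyAlg N"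
  by (intro Polys_intros Const_Polys) auto

lemma Const_X_power_nonzero: "c \<noteq> 0 \<Longrightarrow> Const c * X 1 ^ e \<noteq> (0 :: (nat, 'a::field_char_0) mpoly)"
  by (simp add: X_nonzero Const_def) (metis lookup_single_eq lookup_zero)

lemma triangular_not_Polys:
  assumes "triangular N F" "N \<ge> 1"
  shows "F \<notin> PolyAlg N"
proof -
  obtain c e L where c: "c \<noteq> 0" and L: "L \<in> PolyAlg N" and F: "F = Const c * X 1 ^ e * X (Suc N) + L"
    using assms(1) by (auto simp: triangular_def)
  have "Suc N \<notin> {1..N}" by simp
  then show ?thesis
    unfolding F using Const_X_power_Polys[OF assms(2)] Const_X_power_nonzero[OF c] L
    by (rule not_in_Polys)
qed

lemma pq_Polys: "1 \<le> t \<Longrightarrow> t < N \<Longrightarrow> (pq t :: (nat, 'a::field_char_0) mpoly) \<in> PolyAlg (Suc N)"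
  by (rule triangular_Polys[OF triangular_pq]) auto

lemma pq_not_Polys: "t \<ge> 1 \<Longrightarrow> (pq t :: (nat, 'a::field_char_0) mpoly) \<notin> PolyAlg (Suc t)"
  by (rule triangular_not_Polys[OF triangular_pq]) auto

lemma inj_on_pq: "inj_on (pq :: nat \<Rightarrow> (nat, 'a::field_char_0) mpoly) {1..}"
proof (rule linorder_inj_onI)
  fix s t :: nat assume "s < t" "s \<in> {1..}" "t \<in> {1..}"
  then show "pq s \<noteq> (pq t :: (nat, 'a) mpoly)"
    using pq_Polys[of s t, where 'a = 'a] pq_not_Polys[of t, where 'a = 'a] by auto
qed auto

abbreviation generators :: "nat \<Rightarrow> (nat, 'a::comm_ring_1) mpoly set" where
  "generators N \<equiv> insert (X 1) (pq ` {1..N})"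

lemma generators_Polys: "generators N \<subseteq> (PolyAlg (N + 2) :: (nat, 'a::field_char_0) mpoly set)"
  using pq_Polys[of _ "Suc N", where 'a = 'a] by (auto intro: X_Polys)

lemma alg_independent_generators: "alg_independent (generators N :: (nat, 'a::field_char_0) mpoly set)"
proof (induction N)
  case 0
  \<comment> \<open>x_1 is brought into the shape w x_i + L over the empty set of variables.\<close>
  have "alg_independent (insert (1 * X 1 + 0 :: (nat, 'a) mpoly) {})"
    by (rule alg_independent_insert[where V = "{}"]) (simp_all add: alg_independent_empty)
  then show ?case by simp
next
  case (Suc N)
  obtain c e L where zc: "c \<noteq> 0" "L \<in> PolyAlg (N + 2)"
    and pq: "pq (Suc N) = Const c * X 1 ^ e * X (Suc (N + 2)) + (L :: (nat, 'a) mpoly)"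
    using triangular_pq[of "Suc N", where 'a = 'a] by (auto simp: triangular_def)
  have "alg_independent (insert (pq (Suc N)) (generators N) :: (nat, 'a) mpoly set)"
    unfolding pq using zc
    by (intro alg_independent_insert[OF Suc generators_Polys] Const_X_power_Polys
        Const_X_power_nonzero) auto
  then show ?case by (simp add: atLeastAtMostSuc_conv insert_commute)
qed

section \<open>Invariants\<close>

text \<open>Elements that some power of x carries into \<open>adjoin R S\<close> form a ring:
  exponents add up for sums and products.\<close>

lemma adjoin_denominator:
  assumes "F \<in> adjoin R G" and x: "x \<in> adjoin R S" and G: "\<And>s. s \<in> G \<Longrightarrow> \<exists>M. x ^ M * s \<in> adjoin R S"
  shows "\<exists>M. x ^ M * F \<in> adjoin R S"
  using assms(1)
proof induction
  case (uminus a)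
  then show ?case by (metis adjoin.uminus mult_minus_right)
next
  case (add a b)
  then obtain M M' where "x ^ M * a \<in> adjoin R S" "x ^ M' * b \<in> adjoin R S" by blast
  then have "x ^ M' * (x ^ M * a) + x ^ M * (x ^ M' * b) \<in> adjoin R S"
    using adjoin_power[OF x] by (blast intro: adjoin.add adjoin.mult)
  also have "x ^ M' * (x ^ M * a) + x ^ M * (x ^ M' * b) = x ^ (M + M') * (a + b)"
    by (simp add: power_add algebra_simps)
  finally show ?case by blast
next
  case (mult a b)
  then obtain M M' where "x ^ M * a \<in> adjoin R S" "x ^ M' * b \<in> adjoin R S" by blast
  then have "(x ^ M * a) * (x ^ M' * b) \<in> adjoin R S" by (rule adjoin.mult)
  also have "(x ^ M * a) * (x ^ M' * b) = x ^ (M + M') * (a * b)"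
    by (simp add: power_add mult_ac)
  finally show ?case by blast
next
  case (base a)
  then show ?case by (intro exI[of _ 0]) (simp add: adjoin.base)
next
  case zero
  show ?case by (simp add: adjoin.zero)
next
  case one
  show ?case by (intro exI[of _ 0]) (simp add: adjoin.one)
qed (rule G)

text \<open>Each \<open>pq t\<close> is solved for its top variable x_{t+2}; x_2 is the one variable
  that no generator supplies.\<close>

lemma Polys_denominator:
  fixes F :: "(nat, 'a::field_char_0) mpoly"
  assumes "F \<in> PolyAlg (t + 2)" "t \<le> N"
  shows "\<exists>M. X 1 ^ M * F \<in> adjoin (range Const) (insert (X 2) (generators N))"
  using assms
proof (induction t arbitrary: F)
  case 0
  have "\<exists>M. X 1 ^ M * s \<in> adjoin (range Const) (insert (X 2) (generators N))"
    if "s \<in> X ` {1..0 + 2}" for s :: "(nat, 'a) mpoly"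
  proof -
    have "{1..0 + 2::nat} = {1, 2}" by auto
    then have "s = X 1 \<or> s = X 2" using that by auto
    then show ?thesis by (intro exI[of _ 0]) (auto intro: adjoin.gen)
  qed
  then show ?case
    by (intro adjoin_denominator[OF Polys_adjoin[OF 0(1)]] adjoin.gen) auto
next
  case (Suc t)
  let ?B = "adjoin (range Const) (insert (X 2) (generators N)) :: (nat, 'a) mpoly set"
  have "\<exists>M. X 1 ^ M * s \<in> ?B" if s: "s \<in> X ` {1..Suc t + 2}" for s
  proof (cases "s \<in> X ` {1..t + 2}")
    case True
    then show ?thesis using Suc by (auto intro: X_Polys)
  next
    case False
    then have s: "s = X (Suc (t + 2))" using s by (auto simp: atLeastAtMostSuc_conv)
    obtain c e L where c: "c \<noteq> 0" and L: "L \<in> PolyAlg (t + 2)"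
      and pq: "pq (Suc t) = Const c * X 1 ^ e * s + (L :: (nat, 'a) mpoly)"
      using triangular_pq[of "Suc t", where 'a = 'a] by (auto simp: triangular_def s)
    obtain M where M: "X 1 ^ M * L \<in> ?B"
      using Suc L by auto
    \<comment> \<open>M clears the lower part L, so the difference is x_1^(M+e) times the top
      variable, up to c.\<close>
    have "Const (inverse c) * (X 1 ^ M * pq (Suc t) + - (X 1 ^ M * L)) \<in> ?B"
      using Suc.prems
      by (intro adjoin.mult[OF _ adjoin.add[OF adjoin.mult adjoin.uminus[OF M]]] adjoin_power)
        (auto intro: adjoin.intros)
    also have "Const (inverse c) * (X 1 ^ M * pq (Suc t) + - (X 1 ^ M * L)) =
        (Const (inverse c) * Const c) * (X 1 ^ (M + e) * s)"
      by (simp add: pq power_add algebra_simps)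
    also have "Const (inverse c) * Const c = (1 :: (nat, 'a) mpoly)"
      using c by (simp add: Const_1 flip: Const_mult)
    finally show ?thesis by auto
  qed
  then show ?case
    by (intro adjoin_denominator[OF Polys_adjoin[OF Suc.prems(1)]] adjoin.gen) auto
qed

lemma sigma_adjoin_generators: "F \<in> adjoin (range Const) (generators N) \<Longrightarrow> sigma F = F"
  by (induction rule: adjoin.induct) (auto simp: sigma_simps sigma_Const sigma_X sigma_pq)

lemma invariants_denominator:
  fixes F :: "(nat, 'a::field_char_0) mpoly"
  assumes "F \<in> invariants (N + 2)"
  shows "\<exists>M. X 1 ^ M * F \<in> adjoin (range Const) (generators N)"
proof -
  obtain M where M: "X 1 ^ M * F \<in> adjoin (range Const) (insert (X 2) (generators N))"
    using Polys_denominator[of F N N] assms by (auto simp: invariants_def)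
  define G where "G = X 1 ^ M * F"
  have \<sigma>G: "sigma G = G"
    using assms by (simp add: G_def invariants_def sigma_mult sigma_X1_power del: One_nat_def)
  obtain f where f: "\<And>j. coeff f j \<in> adjoin (range Const) (generators N)" and "G = poly f (X 2)"
    using adjoin_insert_poly[OF M] unfolding G_def by blast
  have "map_poly sigma f = f"
    by (rule map_poly_fixed) (auto intro: sigma_adjoin_generators f simp: sigma_0)
  then have \<sigma>: "sigma (poly f a) = poly f (sigma a)" for a
    unfolding sigma_def by (simp add: peval_poly)
  have "poly f (X 2 + of_nat k * X 1) = G" for k
  proof (induction k)
    case (Suc k)
    then have "sigma (poly f (X 2 + of_nat k * X 1)) = G" by (simp add: \<sigma>G)
    then show ?case by (simp add: \<sigma> sigma_simps sigma_X algebra_simps)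
  qed (simp add: \<open>G = poly f (X 2)\<close>)
  then have "f = [:G:]"
    by (rule constant_on_progression[OF X_nonzero])
  \<comment> \<open>G is now the coefficient of f at 0, and the coefficients of f lie in the algebra
    of the generators.\<close>
  then show ?thesis using f[of 0] G_def by auto
qed

section \<open>Degrees of the generators\<close>

lemma homogeneous_sign: "homogeneous 0 ((-1) ^ k)"
  using homogeneous_of_nat[of 1] homogeneous_uminus[of 0 1]
  by (cases "even k") simp_all

lemma homogeneous_numeral: "homogeneous 0 (numeral w)"
  using homogeneous_of_nat[of "numeral w"] by simp

lemma homogeneous_alternating_sum:
  assumes "\<And>l. homogeneous 1 (B l)"
  shows "homogeneous 2 (\<Sum>l<k. (-1) ^ Suc l * X (k - l) * B l)"
  using assms
  by (intro homogeneous_sum homogeneous_mult[where d = 1 and e = 1]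
      homogeneous_mult[where d = 0 and e = 1] homogeneous_sign homogeneous_X) simp_all

lemma homogeneous_XX: "homogeneous 2 (X i * X j)"
  by (rule homogeneous_mult[OF homogeneous_X homogeneous_X]) simp

lemma homogeneous_p:
  assumes "k \<ge> 1"
  shows "homogeneous 2 (p k)"
  unfolding p_W[OF assms] power2_eq_square pW_def
  by (intro homogeneous_add homogeneous_alternating_sum homogeneous_XX homogeneous_W
      homogeneous_mult[OF homogeneous_numeral homogeneous_W]) simp_all

lemma homogeneous_g: "homogeneous 2 (g k)"
  unfolding g_def gW_def
  by (intro homogeneous_add homogeneous_alternating_sum homogeneous_XX
      homogeneous_mult[OF homogeneous_of_nat homogeneous_W]) simp_all

lemma homogeneous_q:
  assumes "k \<ge> 1"
  shows "homogeneous 3 (q k)"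
proof -
  have "homogeneous 2 (g k - (if k = 1 then p k else 0) :: (nat, 'a) mpoly)"
    using homogeneous_p[OF assms] by (auto intro: homogeneous_diff homogeneous_g)
  moreover have "homogeneous 1 (- X 2 :: (nat, 'a) mpoly)"
    by (intro homogeneous_uminus homogeneous_X)
  ultimately show ?thesis
    unfolding q_W[OF assms]
    by (intro homogeneous_add homogeneous_mult[where d = 1 and e = 2] homogeneous_X homogeneous_p assms)
      simp_all
qed

lemma triangular_nonzero: "triangular N F \<Longrightarrow> N \<ge> 1 \<Longrightarrow> F \<noteq> 0"
  using triangular_not_Polys by force

lemma total_degree_p:
  assumes "k \<ge> 1"
  shows "total_degree (p k :: (nat, 'a::field_char_0) mpoly) = 2"
  using homogeneous_p[OF assms]
  by (rule total_degree_homogeneous, intro triangular_nonzero[OF triangular_p]) (use assms in auto)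

lemma total_degree_q:
  assumes "k \<ge> 1"
  shows "total_degree (q k :: (nat, 'a::field_char_0) mpoly) = 3"
  using homogeneous_q[OF assms]
  by (rule total_degree_homogeneous, intro triangular_nonzero[OF triangular_q]) (use assms in auto)

section \<open>The transcendence basis\<close>

lemma transcendence_basis_generators:
  "transcendence_basis (invariants (N + 2)) (generators N :: (nat, 'a::field_char_0) mpoly set)"
  unfolding transcendence_basis_def
proof (intro conjI ballI)
  show "generators N \<subseteq> (invariants (N + 2) :: (nat, 'a) mpoly set)"
    using generators_Polys[of N] by (auto simp: invariants_def sigma_X sigma_pq)
  show "alg_independent (generators N :: (nat, 'a) mpoly set)"
    by (rule alg_independent_generators)
  let ?A = "adjoin (range Const) (generators N) :: (nat, 'a) mpoly set"
  fix a :: "(nat, 'a) mpoly" assume "a \<in> invariants (N + 2)"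
  then obtain M where M: "X 1 ^ M * a \<in> ?A"
    using invariants_denominator by blast
  have "- (X 1 ^ M * a) \<in> ?A" "X 1 ^ M \<in> ?A"
    using M by (auto intro: adjoin.uminus adjoin_power adjoin.gen)
  then show "algebraic_over ?A a"
    unfolding algebraic_over_def
    \<comment> \<open>The invariant a is a root of the linear polynomial x_1^M T - x_1^M a over the
      algebra.\<close>
    by (intro exI[of _ "[:- (X 1 ^ M * a), X 1 ^ M:]"])
      (auto simp: X_nonzero coeff_pCons mult.commute intro: adjoin.zero split: nat.split)
qed

section \<open>Invariants of the localization\<close>

lemma invariants_loc_Fract:
  "invariants_loc N = {Fract F (X 1 ^ k) | F k. F \<in> (invariants N :: (nat, 'a::field_char_0) mpoly set)}"
proof (intro equalityI subsetI)
  fix w :: "(nat, 'a) mpoly fract" assume "w \<in> invariants_loc N"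
  then obtain F k where F: "F \<in> PolyAlg N" "w = Fract F (X 1 ^ k)" "sigma_loc w = w"
    by (auto simp: invariants_loc_def PolyAlg_loc_def)
  \<comment> \<open>The denominator is fixed, so the equation of fractions compares
    numerators.\<close>
  then have "sigma F = F"
    unfolding sigma_loc_Fract F(2) by (simp add: eq_fract X_nonzero)
  then show "w \<in> {Fract F (X 1 ^ k) | F k. F \<in> invariants N}"
    using F by (auto simp: invariants_def)
qed (auto simp: invariants_loc_def PolyAlg_loc_def invariants_def sigma_loc_Fract simp del: One_nat_def)

lemma invariants_0: "0 \<in> invariants N"
  and invariants_1: "1 \<in> invariants N"
  by (simp_all add: invariants_def sigma_0 sigma_1)

lemma invariants_X1_power: "N \<ge> 1 \<Longrightarrow> X 1 ^ k \<in> invariants N"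
  using sigma_X1_power[of k] by (auto simp: invariants_def intro!: Polys_intros)

lemma invariants_add: "F \<in> invariants N \<Longrightarrow> G \<in> invariants N \<Longrightarrow> F + G \<in> invariants N"
  and invariants_uminus: "F \<in> invariants N \<Longrightarrow> - F \<in> invariants N"
  and invariants_mult: "F \<in> invariants N \<Longrightarrow> G \<in> invariants N \<Longrightarrow> F * G \<in> invariants N"
  by (simp_all add: invariants_def sigma_simps Polys_intros)

lemma to_fract_invariants:
  fixes F :: "(nat, 'a::field_char_0) mpoly"
  assumes "F \<in> invariants N"
  shows "to_fract F \<in> invariants_loc N"
proof -
  have "to_fract F = Fract F (X 1 ^ 0)" by (simp add: to_fract_def)
  then show ?thesis unfolding invariants_loc_Fract using assms by blast
qed

text \<open>Fractions of invariants over powers of x_1 are closed under the ring operations, with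
  common denominator x_1^(k+l).\<close>

lemma adjoin_invariants_loc:
  assumes N: "N \<ge> 1"
    and RS: "R \<subseteq> invariants_loc N" "S \<subseteq> (invariants_loc N :: (nat, 'a::field_char_0) mpoly fract set)"
  shows "adjoin R S \<subseteq> invariants_loc N"
proof
  fix a assume "a \<in> adjoin R S"
  then show "a \<in> invariants_loc N"
  proof induction
    case zero
    have "0 = to_fract (0 :: (nat, 'a) mpoly)" by simp
    then show ?case by (metis invariants_0 to_fract_invariants)
  next
    case one
    have "1 = to_fract (1 :: (nat, 'a) mpoly)" by simp
    then show ?case by (metis invariants_1 to_fract_invariants)
  next
    case (uminus a)
    then obtain F k where F: "F \<in> invariants N" "a = Fract F (X 1 ^ k)"
      unfolding invariants_loc_Fract by blast
    have "- a = Fract (- F) (X 1 ^ k)" by (simp add: F)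
    then show ?case unfolding invariants_loc_Fract using invariants_uminus[OF F(1)] by blast
  next
    case (add a b)
    then obtain F k G l where F: "F \<in> invariants N" "a = Fract F (X 1 ^ k)"
      and G: "G \<in> invariants N" "b = Fract G (X 1 ^ l)"
      unfolding invariants_loc_Fract by blast
    have "a + b = Fract (F * X 1 ^ l + G * X 1 ^ k) (X 1 ^ (k + l))"
      by (simp add: F G X_nonzero power_add)
    moreover have "F * X 1 ^ l + G * X 1 ^ k \<in> invariants N"
      by (intro invariants_add invariants_mult invariants_X1_power F G N)
    ultimately show ?case unfolding invariants_loc_Fract by blast
  next
    case (mult a b)
    then obtain F k G l where F: "F \<in> invariants N" "a = Fract F (X 1 ^ k)"
      and G: "G \<in> invariants N" "b = Fract G (X 1 ^ l)"
      unfolding invariants_loc_Fract by blast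
    have "a * b = Fract (F * G) (X 1 ^ (k + l))"
      by (simp add: F G power_add)
    moreover have "F * G \<in> invariants N"
      by (intro invariants_mult F G)
    ultimately show ?case unfolding invariants_loc_Fract by blast
  qed (use RS in blast)+
qed

lemma invariants_loc_generators:
  "invariants_loc (N + 2) =
     adjoin (adjoin (to_fract ` range Const) {to_fract (X 1), inverse (to_fract (X 1))})
       (to_fract ` pq ` {1..N} :: (nat, 'a::field_char_0) mpoly fract set)"
  (is "_ = adjoin ?R ?S")
proof
  have gen: "generators N \<subseteq> (invariants (N + 2) :: (nat, 'a) mpoly set)"
    using transcendence_basis_generators by (auto simp: transcendence_basis_def)
  have "inverse (to_fract (X 1)) = Fract 1 (X 1 ^ 1 :: (nat, 'a) mpoly)"
    by (simp add: to_fract_def)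
  then have "inverse (to_fract (X 1)) \<in> (invariants_loc (N + 2) :: (nat, 'a) mpoly fract set)"
    unfolding invariants_loc_Fract using invariants_1 by blast
  moreover have "Const c \<in> invariants (N + 2)" for c :: 'a
    by (simp add: invariants_def sigma_Const)
  ultimately show "adjoin ?R ?S \<subseteq> invariants_loc (N + 2)"
    using gen by (intro adjoin_invariants_loc) (auto intro!: to_fract_invariants)
next
  show "invariants_loc (N + 2) \<subseteq> adjoin ?R ?S"
  proof
    fix w :: "(nat, 'a) mpoly fract" assume "w \<in> invariants_loc (N + 2)"
    then obtain F k where F: "F \<in> invariants (N + 2)" and w: "w = Fract F (X 1 ^ k)"
      unfolding invariants_loc_Fract by blast
    obtain M where M: "X 1 ^ M * F \<in> adjoin (range Const) (generators N)"
      using invariants_denominator[OF F] by blast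
    let ?x = "to_fract (X 1) :: (nat, 'a) mpoly fract"
    have x: "?x \<in> adjoin ?R ?S" "inverse ?x \<in> adjoin ?R ?S"
      by (auto intro: adjoin.intros)
    have "to_fract F' \<in> adjoin ?R ?S" if "F' \<in> adjoin (range Const) (generators N)" for F'
      using that
    proof induction
      case (gen s)
      then show ?case using x(1) by (auto intro: adjoin.gen)
    qed (auto intro: adjoin.intros)
    \<comment> \<open>x_1^M brings F into the algebra; dividing by x_1^(M+k) undoes this and
      restores the denominator of w.\<close>
    then have "inverse ?x ^ (M + k) * to_fract (X 1 ^ M * F) \<in> adjoin ?R ?S"
      using M x by (intro adjoin.mult adjoin_power)
    moreover have "to_fract (X 1 ^ j) = ?x ^ j" for j
      by (induction j) simp_all
    ultimately show "w \<in> adjoin ?R ?S"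
      by (simp add: w Fract_conv_to_fract power_add X_nonzero field_simps power_inverse)
  qed
qed

text \<open>p_k is \<open>pq (2 * k - 1)\<close> and q_k is \<open>pq (2 * k)\<close>.\<close>

lemma generators_p_q:
  "pq ` {1..n - 1} = p ` {1..n div 2} \<union> q ` {1..(n - 1) div 2}"
proof (intro equalityI subsetI)
  fix F assume "F \<in> pq ` {1..n - 1}"
  then obtain t where t: "1 \<le> t" "t \<le> n - 1" "F = pq t" by auto
  then show "F \<in> p ` {1..n div 2} \<union> q ` {1..(n - 1) div 2}"
    by (auto simp: pq_def elim!: oddE evenE)
next
  fix F assume "F \<in> p ` {1..n div 2} \<union> q ` {1..(n - 1) div 2}"
  then show "F \<in> pq ` {1..n - 1}"
  proof
    assume "F \<in> p ` {1..n div 2}"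
    then obtain k where "1 \<le> k" "k \<le> n div 2" "F = p k" by auto
    then show ?thesis by (intro image_eqI[of _ _ "2 * k - 1"]) (auto simp: pq_def)
  next
    assume "F \<in> q ` {1..(n - 1) div 2}"
    then obtain k where "1 \<le> k" "k \<le> (n - 1) div 2" "F = q k" by auto
    then show ?thesis by (intro image_eqI[of _ _ "2 * k"]) (auto simp: pq_def)
  qed
qed

theorem theorem1p5:
  fixes n m \<mu> :: nat
    and ps qs :: "(nat, 'a::field_char_0) mpoly list"
  assumes "n \<ge> 2"
    and "m = n div 2" and "\<mu> = (n - 1) div 2"
    and "ps = map p [1..<m + 1]" and "qs = map q [1..<\<mu> + 1]"
  shows "distinct (X 1 # ps @ qs)
    \<and> transcendence_basis (invariants (n + 1)) (set (X 1 # ps @ qs))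
    \<and> (\<forall>f \<in> set ps. total_degree f = 2)
    \<and> (\<forall>f \<in> set qs. total_degree f = 3)
    \<and> invariants_loc (n + 1) =
        adjoin (adjoin (to_fract ` range Const) {to_fract (X 1), inverse (to_fract (X 1))})
          (to_fract ` set (ps @ qs))"
proof -
  have n: "n + 1 = (n - 1) + 2" using assms(1) by simp
  have ps: "set ps = p ` {1..n div 2}" and qs: "set qs = q ` {1..(n - 1) div 2}"
    by (simp_all add: assms del: upt_Suc One_nat_def)
      (simp_all add: atLeastLessThanSuc_atLeastAtMost)
  have "set (ps @ qs) = pq ` {1..n - 1}"
    by (simp only: set_append ps qs generators_p_q)
  then have set: "set (ps @ qs) = pq ` {1..n - 1}" "set (X 1 # ps @ qs) = generators (n - 1)"
    by simp_all
  \<comment> \<open>Distinctness follows by counting: the set has as many elements as the list has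
    entries, since [n/2] + [(n-1)/2] = n - 1.\<close>
  have "card (set (X 1 # ps @ qs)) = Suc (n - 1)"
  proof -
    have "X 1 \<noteq> (pq t :: (nat, 'a) mpoly)" if "t \<ge> 1" for t
    proof -
      have "(X 1 :: (nat, 'a) mpoly) \<in> PolyAlg (Suc t)" by (rule X_Polys) simp
      then show ?thesis using pq_not_Polys[OF that, where 'a = 'a] by metis
    qed
    then have "X 1 \<notin> (pq ` {1..n - 1} :: (nat, 'a) mpoly set)"
      by (metis imageE atLeastAtMost_iff)
    moreover have "inj_on (pq :: nat \<Rightarrow> (nat, 'a) mpoly) {1..n - 1}"
      by (rule inj_on_subset[OF inj_on_pq]) auto
    ultimately show ?thesis unfolding set by (simp add: card_image)
  qed
  moreover have "length (X 1 # ps @ qs) = Suc (n - 1)"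
    using assms by (simp del: upt_Suc)
  ultimately have "distinct (X 1 # ps @ qs)"
    by (metis card_distinct)
  moreover have "total_degree f = 2" if "f \<in> set ps" for f
    using that unfolding ps
    by (auto simp: total_degree_p)
  moreover have "total_degree f = 3" if "f \<in> set qs" for f
    using that unfolding qs
    by (auto simp: total_degree_q)
  ultimately show ?thesis
    unfolding set n using transcendence_basis_generators invariants_loc_generators by blast
qed

end
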